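(* Let $K$ be a field, let $n_1<n_2<n_3<n_4$ be positive integers with $\gcd(n_1,n_2,n_3,n_4)=1$, and let $C$ be the monomial curve $x_i=t^{n_i}$ ($1\le i\le 4$) in $\mathbb{A}^4(K)$. Assume that $C$ is Gorenstein and not a complete intersection, that $C$ has Cohen-Macaulay tangent cone at the origin, and that $I(C)$ is minimally generated by $$f_1=x_1^{a_1}-x_3^{a_{13}}x_4^{a_{14}},\quad f_2=x_2^{a_2}-x_1^{a_{21}}x_3^{a_{23}},\quad f_3=x_3^{a_3}-x_2^{a_{32}}x_4^{a_{34}},$$ $$f_4=x_4^{a_4}-x_1^{a_{41}}x_2^{a_{42}},\quad f_5=x_1^{a_{21}}x_4^{a_{34}}-x_2^{a_{42}}x_3^{a_{13}},$$ where $a_i>1$ and $0<a_{ij}<a_j$ for all the exponents appearing. Suppose that $a_3>a_{32}+a_{34}$, $a_{32}<a_{42}$ and $a_{14}\le a_{34}$. If $a_2\le a_{21}+a_{23}$, $a_{42}+a_{13}\le a_{21}+a_{34}$ and $a_3+a_{13}\le a_1+a_{32}+a_{34}-a_{14}$, then $I(C)_*$ is minimally generated by the six polynomials $$G_*=\{x_3^{a_{13}}x_4^{a_{14}},\ p_2,\ x_2^{a_{32}}x_4^{a_{34}},\ x_4^{a_4},\ p_5,\ p_6\},$$ where $p_2=x_2^{a_2}$ if $a_2<a_{21}+a_{23}$ and $p_2=x_2^{a_2}-x_1^{a_{21}}x_3^{a_{23}}$ if $a_2=a_{21}+a_{23}$; $p_5=x_2^{a_{42}}x_3^{a_{13}}$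 if $a_{42}+a_{13}<a_{21}+a_{34}$ and $p_5=x_1^{a_{21}}x_4^{a_{34}}-x_2^{a_{42}}x_3^{a_{13}}$ if $a_{42}+a_{13}=a_{21}+a_{34}$; $p_6=x_3^{a_3+a_{13}}$ if $a_3+a_{13}<a_1+a_{32}+a_{34}-a_{14}$ and $p_6=x_3^{a_3+a_{13}}-x_1^{a_1}x_2^{a_{32}}x_4^{a_{34}-a_{14}}$ if $a_3+a_{13}=a_1+a_{32}+a_{34}-a_{14}$.
   Context: $I(C)$ is the kernel of the $K$-algebra homomorphism $\phi:K[x_1,\ldots,x_4]\to K[t]$, $\phi(x_i)=t^{n_i}$. $C$ is Gorenstein when the numerical semigroup generated by $n_1,\ldots,n_4$ is symmetric, and it is not a complete intersection when $I(C)$ cannot be generated by three elements. For $0\ne f\in I(C)$, $f_*$ denotes the homogeneous summand of $f$ of least (standard) degree, and $I(C)_*$ is the ideal of $K[x_1,\ldots,x_4]$ generated by all $f_*$, $f\in I(C)$; it is the defining ideal of the tangent cone of $C$ at the origin. $C$ has Cohen-Macaulay tangent cone at the origin if $K[x_1,\ldots,x_4]/I(C)_*$ is Cohen-Macaulay. In the described situation the exponents satisfy (Bresinsky) $a_1=a_{21}+a_{41}$, $a_2=a_{32}+a_{42}$, $a_3=a_{13}+a_{23}$, $a_4=a_{14}+a_{34}$. *)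

theory Defs
  imports
    "HOL-Library.Poly_Mapping"
    "HOL-Library.Numeral_Type"
    "HOL-Library.Extended_Nat"
    "HOL-Algebra.QuotRing"
    "HOL-Algebra.Ring_Divisibility"
    "HOL-Algebra.Algebraic_Closure_Type"
begin

section \<open>Polynomials in four variables\<close>

text \<open>
  The variables are indexed by the four-element type \<^typ>\<open>4\<close>, whose elements are
  written 1, 2, 3, 4 (an index set only; note that 4 and 0 denote the same element).
  Exponent vectors are \<open>4 \<Rightarrow>\<^sub>0 nat\<close>, and the ring structure (convolution product) is the
  library's instance for \<open>\<Rightarrow>\<^sub>0\<close>.
\<close>

type_synonym 'k poly4 = "(4 \<Rightarrow>\<^sub>0 nat) \<Rightarrow>\<^sub>0 'k"

definition xvar :: "4 \<Rightarrow> 'k::comm_ring_1 poly4" where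
  "xvar i = Poly_Mapping.single (Poly_Mapping.single i 1) 1"

definition mdeg :: "(4 \<Rightarrow>\<^sub>0 nat) \<Rightarrow> nat" where
  "mdeg m = (\<Sum>i\<in>UNIV. Poly_Mapping.lookup m i)"

definition hom_component :: "nat \<Rightarrow> 'k::comm_ring_1 poly4 \<Rightarrow> 'k poly4" where
  "hom_component d f =
     (\<Sum>m | m \<in> Poly_Mapping.keys f \<and> mdeg m = d. Poly_Mapping.single m (Poly_Mapping.lookup f m))"

text \<open>The summand \<open>f\<^sub>*\<close> of least degree; meaningful for \<open>f \<noteq> 0\<close> only.\<close>

definition initial_form :: "'k::comm_ring_1 poly4 \<Rightarrow> 'k poly4" where
  "initial_form f = hom_component (Min (mdeg ` Poly_Mapping.keys f)) f"

section \<open>Ideals and their generators\<close>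

text \<open>
  The ideal generated by a set, i.e. its span in the ring viewed as a module over itself.
  The name \<open>module\<close> alone would refer to the locale of \<open>HOL-Algebra\<close>.
\<close>

definition ideal_gen :: "'a::comm_ring_1 set \<Rightarrow> 'a set" where
  "ideal_gen S = Modules.module.span (*) S"

lemma module_times: "Modules.module ((*) :: 'a::comm_ring_1 \<Rightarrow> 'a \<Rightarrow> 'a)"
  by unfold_locales (auto simp: algebra_simps)

definition minimally_generated_by :: "'a::comm_ring_1 set \<Rightarrow> 'a list \<Rightarrow> bool" where
  "minimally_generated_by I gs \<longleftrightarrow>
     distinct gs \<and> ideal_gen (set gs) = I \<and> (\<forall>H. H \<subset> set gs \<longrightarrow> ideal_gen H \<noteq> I)"

section \<open>Cohen-Macaulay rings\<close>

text \<open>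
  A Noetherian commutative ring is Cohen-Macaulay if depth and codimension agree at every
  maximal ideal (Eisenbud, Commutative Algebra, Section 18.2). The depth of an ideal is the
  largest length of a regular sequence of the ring contained in it, and the codimension
  (height) of a prime ideal is the largest length of a chain of primes descending from it.
\<close>

definition regular_sequence :: "('a, 'm) ring_scheme \<Rightarrow> 'a list \<Rightarrow> bool" where
  "regular_sequence R xs \<longleftrightarrow>
     set xs \<subseteq> carrier R \<and>
     Idl\<^bsub>R\<^esub> (set xs) \<noteq> carrier R \<and>
     (\<forall>i<length xs. \<forall>y\<in>carrier R.
        xs ! i \<otimes>\<^bsub>R\<^esub> y \<in> Idl\<^bsub>R\<^esub> (set (take i xs)) \<longrightarrow> y \<in> Idl\<^bsub>R\<^esub> (set (take i xs)))"

definition depth :: "('a, 'm) ring_scheme \<Rightarrow> 'a set \<Rightarrow> enat" where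
  "depth R I = Sup {enat (length xs) | xs. set xs \<subseteq> I \<and> regular_sequence R xs}"

definition height :: "('a, 'm) ring_scheme \<Rightarrow> 'a set \<Rightarrow> enat" where
  "height R P = Sup {enat n | n. \<exists>Q :: nat \<Rightarrow> 'a set.
     (\<forall>i\<le>n. primeideal (Q i) R) \<and> (\<forall>i<n. Q i \<subset> Q (Suc i)) \<and> Q n = P}"

definition cohen_macaulay :: "('a, 'm) ring_scheme \<Rightarrow> bool" where
  "cohen_macaulay R \<longleftrightarrow>
     cring R \<and> noetherian_ring R \<and> (\<forall>M. maximalideal M R \<longrightarrow> depth R M = height R M)"

section \<open>Monomial curves in affine 4-space\<close>

text \<open>
  The homomorphism of \<open>K\<close>-algebras \<open>K[x\<^sub>1,\<dots>,x\<^sub>4] \<rightarrow> K[t]\<close> with \<open>x\<^sub>i \<mapsto> t\<close> to the power \<open>n i\<close>.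
\<close>

definition curve_hom :: "(4 \<Rightarrow> nat) \<Rightarrow> 'k::comm_ring_1 poly4 \<Rightarrow> 'k poly" where
  "curve_hom n f =
     (\<Sum>m\<in>Poly_Mapping.keys f.
        Polynomial.smult (Poly_Mapping.lookup f m)
          (\<Prod>i\<in>UNIV. Polynomial.monom 1 (n i) ^ Poly_Mapping.lookup m i))"

lemma curve_hom_single:
  "curve_hom n (Poly_Mapping.single m c) =
     Polynomial.smult c (\<Prod>i\<in>UNIV. Polynomial.monom 1 (n i) ^ Poly_Mapping.lookup m i)"
  by (cases "c = 0") (simp_all add: curve_hom_def)

lemma curve_hom_xvar: "curve_hom n (xvar i) = Polynomial.monom 1 (n i)"
proof -
  have "(\<Prod>j\<in>UNIV. Polynomial.monom (1::'a) (n j) ^ Poly_Mapping.lookup (Poly_Mapping.single i 1) j)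
      = (\<Prod>j\<in>UNIV. if j = i then Polynomial.monom 1 (n i) else 1)"
    by (rule prod.cong) (auto simp: lookup_single when_def)
  then show ?thesis
    by (simp add: xvar_def curve_hom_single)
qed

lemma curve_hom_add: "curve_hom n (f + g) = curve_hom n f + curve_hom n g"
  unfolding curve_hom_def
  by (rule setsum_keys_plus_distrib) (simp_all add: smult_add_left)

lemma poly_mapping_sum_singles:
  "f = (\<Sum>m\<in>Poly_Mapping.keys f. Poly_Mapping.single m (Poly_Mapping.lookup f m))"
  by (rule poly_mapping_eqI)
    (auto simp: lookup_sum lookup_single when_def in_keys_iff sum.delta)

lemma curve_hom_sum: "curve_hom n (sum h A) = (\<Sum>a\<in>A. curve_hom n (h a))"
  by (induction A rule: infinite_finite_induct)
    (simp_all add: curve_hom_add, simp_all add: curve_hom_def)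

lemma curve_hom_mult: "curve_hom n (f * g) = curve_hom n f * curve_hom n g"
proof -
  have single: "curve_hom n (Poly_Mapping.single m c * Poly_Mapping.single m' c') =
      curve_hom n (Poly_Mapping.single m c) * curve_hom n (Poly_Mapping.single m' c')"
    for m m' and c c' :: 'a
    by (simp add: mult_single curve_hom_single lookup_add power_add prod.distrib mult.commute)
  have "f * g = (\<Sum>m\<in>Poly_Mapping.keys f. \<Sum>m'\<in>Poly_Mapping.keys g.
      Poly_Mapping.single m (Poly_Mapping.lookup f m) * Poly_Mapping.single m' (Poly_Mapping.lookup g m'))"
    by (subst (1) poly_mapping_sum_singles[of f], subst (1) poly_mapping_sum_singles[of g])
      (simp add: sum_product)
  then have "curve_hom n (f * g) =
      (\<Sum>m\<in>Poly_Mapping.keys f. curve_hom n (Poly_Mapping.single m (Poly_Mapping.lookup f m))) *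
      (\<Sum>m'\<in>Poly_Mapping.keys g. curve_hom n (Poly_Mapping.single m' (Poly_Mapping.lookup g m')))"
    by (simp add: curve_hom_sum single sum_product)
  then show ?thesis
    by (simp flip: curve_hom_sum poly_mapping_sum_singles)
qed

definition curve_ideal :: "(4 \<Rightarrow> nat) \<Rightarrow> 'k::field poly4 set" where
  "curve_ideal n = {f. curve_hom n f = 0}"

definition tangent_ideal :: "'k::field poly4 set \<Rightarrow> 'k poly4 set" where
  "tangent_ideal I = ideal_gen {initial_form f | f. f \<in> I \<and> f \<noteq> 0}"

definition numerical_semigroup :: "(4 \<Rightarrow> nat) \<Rightarrow> int set" where
  "numerical_semigroup n = {\<Sum>i\<in>UNIV. int (c i * n i) | c :: 4 \<Rightarrow> nat. True}"

text \<open>\<open>F\<close> is the Frobenius number, which is \<open>-1\<close> if the semigroup is all of the naturals.\<close>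

definition symmetric_semigroup :: "int set \<Rightarrow> bool" where
  "symmetric_semigroup S \<longleftrightarrow>
     (\<exists>F. F \<notin> S \<and> (\<forall>z>F. z \<in> S) \<and> (\<forall>z. z \<notin> S \<longrightarrow> F - z \<in> S))"

definition gorenstein_curve :: "(4 \<Rightarrow> nat) \<Rightarrow> bool" where
  "gorenstein_curve n \<longleftrightarrow> symmetric_semigroup (numerical_semigroup n)"

text \<open>A curve in affine 4-space has codimension three.\<close>

definition complete_intersection_curve :: "'k::field poly4 set \<Rightarrow> bool" where
  "complete_intersection_curve I \<longleftrightarrow> (\<exists>g1 g2 g3. I = ideal_gen {g1, g2, g3})"

definition cm_tangent_cone :: "'k::field poly4 set \<Rightarrow> bool" where
  "cm_tangent_cone I \<longleftrightarrow> cohen_macaulay (ring_of_type_algebra Quot tangent_ideal I)"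

end

theory Submission
  imports Defs
begin

text \<open>
  Each \<open>f\<^sub>i\<close>, together with \<open>f\<^sub>6 = x\<^sub>3 ^ (a3 + a13) - x\<^sub>1 ^ a1 * x\<^sub>2 ^ a32 * x\<^sub>4 ^ (a34 - a14)\<close>, gives a
  rewriting rule on monomials that keeps the weight (the exponent of \<open>t\<close>) and either raises the
  degree or keeps it and raises the exponent of \<open>x\<^sub>1\<close>. The monomials that no rule applies to turn
  out to have distinct weights. Consequently the reduced form of a monomial is the monomial of
  largest degree of its weight, up to the leading parts of the rules, and these leading parts
  generate the tangent ideal. Minimality is visible on the leading monomials, none of which is
  divisible by a monomial of another generator.
\<close>

lemma exhaust_4: fixes x :: 4 shows "x = 1 \<or> x = 2 \<or> x = 3 \<or> x = 4"
proof (induct x)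
  case (of_int z)
  then have "z = 0 \<or> z = 1 \<or> z = 2 \<or> z = 3" by auto
  then show ?case by auto
qed

lemma UNIV_4: "UNIV = {1, 2, 3, 4 :: 4}"
  using exhaust_4 by auto

lemma sum_UNIV_4: "(\<Sum>i\<in>UNIV. f i) = f 1 + f 2 + f 3 + f (4 :: 4)"
proof -
  have "(\<Sum>i\<in>UNIV. f i) = (\<Sum>i\<in>{1, 2, 3, 4}. f i)"
    by (simp only: UNIV_4)
  also have "\<dots> = f 1 + f 2 + f 3 + f 4"
    by (simp add: add.assoc)
  finally show ?thesis .
qed

section \<open>Exponent vectors and monomials\<close>

definition expo :: "nat \<Rightarrow> nat \<Rightarrow> nat \<Rightarrow> nat \<Rightarrow> 4 \<Rightarrow>\<^sub>0 nat" where
  "expo a b c d = Poly_Mapping.single 1 a + Poly_Mapping.single 2 b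
     + Poly_Mapping.single 3 c + Poly_Mapping.single 4 d"

lemma lookup_expo [simp]:
  "Poly_Mapping.lookup (expo a b c d) 1 = a" "Poly_Mapping.lookup (expo a b c d) 2 = b"
  "Poly_Mapping.lookup (expo a b c d) 3 = c" "Poly_Mapping.lookup (expo a b c d) 4 = d"
  by (simp_all add: expo_def lookup_add lookup_single when_def)

lemma expo_cases: obtains a b c d where "u = expo a b c d"
proof
  let ?u = "expo (Poly_Mapping.lookup u 1) (Poly_Mapping.lookup u 2)
    (Poly_Mapping.lookup u 3) (Poly_Mapping.lookup u 4)"
  show "u = ?u"
  proof (rule poly_mapping_eqI)
    show "Poly_Mapping.lookup u i = Poly_Mapping.lookup ?u i" for i
      using exhaust_4[of i] by auto
  qed
qed

lemma expo_eq_iff [simp]: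
  "expo a b c d = expo a' b' c' d' \<longleftrightarrow> a = a' \<and> b = b' \<and> c = c' \<and> d = d'"
  by (metis lookup_expo)

lemma expo_add [simp]: "expo a b c d + expo a' b' c' d' = expo (a+a') (b+b') (c+c') (d+d')"
  by (simp add: expo_def single_add ac_simps)

definition exp_dvd :: "(4 \<Rightarrow>\<^sub>0 nat) \<Rightarrow> (4 \<Rightarrow>\<^sub>0 nat) \<Rightarrow> bool" where
  "exp_dvd m u \<longleftrightarrow> (\<exists>v. u = v + m)"

lemma exp_dvd_expo [simp]:
  "exp_dvd (expo a' b' c' d') (expo a b c d) \<longleftrightarrow> a' \<le> a \<and> b' \<le> b \<and> c' \<le> c \<and> d' \<le> d"
  unfolding exp_dvd_def
proof
  assume "\<exists>u. expo a b c d = u + expo a' b' c' d'"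
  then show "a' \<le> a \<and> b' \<le> b \<and> c' \<le> c \<and> d' \<le> d"
    by (metis expo_add expo_cases expo_eq_iff le_add2)
next
  assume "a' \<le> a \<and> b' \<le> b \<and> c' \<le> c \<and> d' \<le> d"
  then show "\<exists>u. expo a b c d = u + expo a' b' c' d'"
    by (intro exI[of _ "expo (a-a') (b-b') (c-c') (d-d')"]) simp
qed

lemma mdeg_expo [simp]: "mdeg (expo a b c d) = a + b + c + d"
  by (simp add: mdeg_def sum_UNIV_4)

lemma mdeg_add: "mdeg (u + v) = mdeg u + mdeg v"
  by (simp add: mdeg_def lookup_add sum.distrib)

abbreviation mon :: "(4 \<Rightarrow>\<^sub>0 nat) \<Rightarrow> 'k::comm_ring_1 poly4" where
  "mon u \<equiv> Poly_Mapping.single u 1"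

lemma keys_binomial:
  assumes "l \<noteq> r"
  shows "Poly_Mapping.keys (mon l - mon r :: 'k::comm_ring_1 poly4) = {l, r}"
  using assms by (auto simp: in_keys_iff lookup_minus lookup_single when_def split: if_splits)

lemma keys_binomialD:
  "m \<in> Poly_Mapping.keys (mon l - mon r :: 'k::comm_ring_1 poly4) \<Longrightarrow> m = l \<or> m = r"
  by (auto simp: in_keys_iff lookup_minus lookup_single when_def split: if_splits)

lemma xvar_power: "xvar i ^ k = mon (Poly_Mapping.single i k)"
  by (induction k) (simp_all add: xvar_def mult_single single_add[symmetric])

lemma xvar_power_expo:
  "xvar 1 ^ a = mon (expo a 0 0 0)" "xvar 2 ^ a = mon (expo 0 a 0 0)"
  "xvar 3 ^ a = mon (expo 0 0 a 0)" "xvar 4 ^ a = mon (expo 0 0 0 a)"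
  by (simp_all add: xvar_power expo_def)

section \<open>Ideals generated by polynomials\<close>

text \<open>A multiplier is a sum of terms, so closure under addition reduces it to single terms. A
  coefficient of an ideal element can then be traced through shifted copies of the
  generators.\<close>

lemma ideal_gen_induct_monomial [consumes 1, case_names zero add gen]:
  fixes S :: "'k::comm_ring_1 poly4 set"
  assumes "f \<in> ideal_gen S" and "P 0" and add: "\<And>f g. P f \<Longrightarrow> P g \<Longrightarrow> P (f + g)"
    and gen: "\<And>u c g. g \<in> S \<Longrightarrow> P (Poly_Mapping.single u c * g)"
  shows "P f"
proof -
  have sum: "P (sum h A)" if "\<And>a. a \<in> A \<Longrightarrow> P (h a)" for h and A :: "(4 \<Rightarrow>\<^sub>0 nat) set"
    using that by (induction A rule: infinite_finite_induct) (auto intro: add \<open>P 0\<close>)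
  have "P (q * g + h)" if "g \<in> S" "P h" for q g h
  proof -
    have "P (q * g)"
      by (subst poly_mapping_sum_singles[of q]) (auto simp: sum_distrib_right intro!: sum gen that)
    from add[OF this \<open>P h\<close>] show ?thesis .
  qed
  with \<open>P 0\<close> show ?thesis
    using assms(1) Modules.module.span_induct_alt[OF module_times, of f S P]
    unfolding ideal_gen_def by blast
qed

text \<open>Every monomial of a term multiple of \<open>g\<close> is divisible by a monomial of
  \<open>g\<close>, so a \<open>u\<close> without such a divisor never occurs.\<close>

lemma lookup_ideal_gen_eq_0:
  fixes S :: "'k::comm_ring_1 poly4 set"
  assumes "f \<in> ideal_gen S"
    and "\<And>g m. g \<in> S \<Longrightarrow> m \<in> Poly_Mapping.keys g \<Longrightarrow> \<not> exp_dvd m u"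
  shows "Poly_Mapping.lookup f u = 0"
  using assms(1)
proof (induction rule: ideal_gen_induct_monomial)
  case (gen v c g)
  have "u \<notin> Poly_Mapping.keys (Poly_Mapping.single v c * g)"
    using keys_mult[of "Poly_Mapping.single v c" g] assms(2)[OF gen, unfolded exp_dvd_def]
    by (fastforce split: if_splits)
  then show ?case by (simp add: in_keys_iff)
qed (simp_all add: lookup_add)

lemma ideal_gen_mono: "S \<subseteq> T \<Longrightarrow> ideal_gen S \<subseteq> ideal_gen T"
  unfolding ideal_gen_def by (rule Modules.module.span_mono[OF module_times])

lemma ideal_gen_base: "g \<in> S \<Longrightarrow> g \<in> ideal_gen S"
  unfolding ideal_gen_def by (rule Modules.module.span_base[OF module_times])

lemma ideal_gen_subsetI: "(\<And>g. g \<in> S \<Longrightarrow> g \<in> ideal_gen T) \<Longrightarrow> ideal_gen S \<subseteq> ideal_gen T"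
  unfolding ideal_gen_def
  by (metis Modules.module.span_minimal[OF module_times]
      Modules.module.subspace_span[OF module_times] subsetI)

lemma ideal_gen_add: "f \<in> ideal_gen S \<Longrightarrow> g \<in> ideal_gen S \<Longrightarrow> f + g \<in> ideal_gen S"
  unfolding ideal_gen_def by (rule Modules.module.span_add[OF module_times])

lemma ideal_gen_mult: "f \<in> ideal_gen S \<Longrightarrow> q * f \<in> ideal_gen S"
  unfolding ideal_gen_def by (rule Modules.module.span_scale[OF module_times])

lemma ideal_gen_sum: "(\<And>a. a \<in> A \<Longrightarrow> h a \<in> ideal_gen S) \<Longrightarrow> sum h A \<in> ideal_gen S"
  unfolding ideal_gen_def by (rule Modules.module.span_sum[OF module_times])

lemma ideal_gen_uminus: "- f \<in> ideal_gen S \<Longrightarrow> f \<in> ideal_gen S"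
  using ideal_gen_mult[of "- f" S "- 1"] by simp

text \<open>The rule for f_5 has its sides in the opposite order to f_5, so its leading part may be
  the negative of p_5.\<close>

lemma ideal_gen_eq_up_to_sign:
  assumes "\<And>g. g \<in> S \<Longrightarrow> g \<in> T \<or> - g \<in> T" "\<And>g. g \<in> T \<Longrightarrow> g \<in> S \<or> - g \<in> S"
  shows "ideal_gen S = ideal_gen T"
proof (intro subset_antisym ideal_gen_subsetI)
  show "g \<in> ideal_gen T" if "g \<in> S" for g
    using assms(1)[OF that] by (metis ideal_gen_base ideal_gen_uminus)
  show "g \<in> ideal_gen S" if "g \<in> T" for g
    using assms(2)[OF that] by (metis ideal_gen_base ideal_gen_uminus)
qed

text \<open>The coefficient of \<open>ls ! i\<close> separates \<open>gs ! i\<close> from the ideal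
  of the other generators: none of their monomials divides \<open>ls ! i\<close>, so it vanishes on
  that ideal.\<close>

lemma minimally_generated_by_if_lead:
  fixes gs :: "'k::comm_ring_1 poly4 list"
  assumes I: "ideal_gen (set gs) = I"
    and lead: "\<And>i. i < length gs \<Longrightarrow> Poly_Mapping.lookup (gs ! i) (ls ! i) \<noteq> 0"
    and indep: "\<And>i j m. i < length gs \<Longrightarrow> j < length gs \<Longrightarrow> i \<noteq> j \<Longrightarrow>
      m \<in> Poly_Mapping.keys (gs ! j) \<Longrightarrow> \<not> exp_dvd m (ls ! i)"
  shows "minimally_generated_by I gs"
  unfolding minimally_generated_by_def
proof (intro conjI allI impI)
  have *: "Poly_Mapping.lookup (gs ! j) (ls ! i) = 0" if "i < length gs" "j < length gs" "i \<noteq> j" for i j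
    using indep[OF that, of "ls ! i"] by (metis add_0 exp_dvd_def in_keys_iff)
  show "distinct gs"
    unfolding distinct_conv_nth using * lead by metis
  show "ideal_gen (set gs) = I" by (fact I)
  fix H assume H: "H \<subset> set gs"
  then obtain i where i: "i < length gs" "gs ! i \<notin> H"
    by (metis in_set_conv_nth psubset_imp_ex_mem DiffE)
  have "Poly_Mapping.lookup f (ls ! i) = 0" if "f \<in> ideal_gen H" for f
    using that
  proof (rule lookup_ideal_gen_eq_0)
    fix g m assume g: "g \<in> H" "m \<in> Poly_Mapping.keys g"
    then obtain j where "j < length gs" "g = gs ! j"
      using H by (metis in_set_conv_nth psubsetD)
    with g i show "\<not> exp_dvd m (ls ! i)" using indep[of i j m] by auto
  qed
  with lead[OF i(1)] have "gs ! i \<notin> ideal_gen H" by blast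
  moreover have "gs ! i \<in> I" using i(1) I ideal_gen_base nth_mem by blast
  ultimately show "ideal_gen H \<noteq> I" by blast
qed

section \<open>Weights and binomials of the curve\<close>

definition weight :: "(4 \<Rightarrow> nat) \<Rightarrow> (4 \<Rightarrow>\<^sub>0 nat) \<Rightarrow> nat" where
  "weight n u = (\<Sum>i\<in>UNIV. Poly_Mapping.lookup u i * n i)"

lemma weight_expo: "weight n (expo a b c d) = a * n 1 + b * n 2 + c * n 3 + d * n 4"
  by (simp add: weight_def sum_UNIV_4)

lemma weight_add: "weight n (u + v) = weight n u + weight n v"
  by (simp add: weight_def lookup_add sum.distrib algebra_simps)

lemma curve_hom_monomial:
  "curve_hom n (Poly_Mapping.single u c) = Polynomial.monom c (weight n u)"
proof -
  have "(\<Prod>i\<in>A. Polynomial.monom (1::'a) (n i) ^ Poly_Mapping.lookup u i)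
      = Polynomial.monom 1 (\<Sum>i\<in>A. Poly_Mapping.lookup u i * n i)" if "finite A" for A
    using that by induction (auto simp: monom_power mult_monom mult.commute)
  from this[of UNIV] show ?thesis
    by (simp add: curve_hom_single weight_def smult_monom)
qed

lemma coeff_curve_hom:
  "coeff (curve_hom n f) w = (\<Sum>u | u \<in> Poly_Mapping.keys f \<and> weight n u = w. Poly_Mapping.lookup f u)"
proof -
  have "curve_hom n f = (\<Sum>u\<in>Poly_Mapping.keys f. Polynomial.monom (Poly_Mapping.lookup f u) (weight n u))"
    by (subst poly_mapping_sum_singles[of f]) (simp add: curve_hom_sum curve_hom_monomial)
  then show ?thesis
    by (simp add: coeff_sum sum.inter_filter)
qed

lemma binomial_mem_curve_ideal_iff:
  "(mon u - mon v :: 'k::field poly4) \<in> curve_ideal n \<longleftrightarrow> weight n u = weight n v"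
proof -
  have "curve_hom n (mon u - mon v :: 'k poly4)
      = Polynomial.monom 1 (weight n u) - Polynomial.monom 1 (weight n v)"
    using curve_hom_add[of n "mon u - mon v :: 'k poly4" "mon v"]
    by (simp add: curve_hom_monomial algebra_simps)
  then show ?thesis
    by (auto simp: curve_ideal_def monom_eq_iff')
qed

section \<open>Rewriting rules and the tangent cone\<close>

definition reduced :: "((4 \<Rightarrow>\<^sub>0 nat) \<times> (4 \<Rightarrow>\<^sub>0 nat)) set \<Rightarrow> (4 \<Rightarrow>\<^sub>0 nat) \<Rightarrow> bool" where
  "reduced R u \<longleftrightarrow> (\<forall>(l, r)\<in>R. \<not> exp_dvd l u)"

definition lead_part :: "(4 \<Rightarrow>\<^sub>0 nat) \<times> (4 \<Rightarrow>\<^sub>0 nat) \<Rightarrow> 'k::comm_ring_1 poly4" where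
  "lead_part = (\<lambda>(l, r). if mdeg l < mdeg r then mon l else mon l - mon r)"

lemma hom_component_eq_sum:
  assumes "finite A" "Poly_Mapping.keys f \<subseteq> A"
  shows "hom_component d f =
    (\<Sum>m\<in>A. if mdeg m = d then Poly_Mapping.single m (Poly_Mapping.lookup f m) else 0)"
proof -
  have "hom_component d f = (\<Sum>m\<in>Poly_Mapping.keys f.
      if mdeg m = d then Poly_Mapping.single m (Poly_Mapping.lookup f m) else 0)"
    unfolding hom_component_def by (simp add: sum.inter_filter)
  also have "\<dots> = (\<Sum>m\<in>A. if mdeg m = d then Poly_Mapping.single m (Poly_Mapping.lookup f m) else 0)"
    using assms by (intro sum.mono_neutral_left) (auto simp: in_keys_iff)
  finally show ?thesis .
qed

lemma initial_form_binomial: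
  assumes "l \<noteq> r" "mdeg l \<le> mdeg r"
  shows "initial_form (mon l - mon r :: 'k::comm_ring_1 poly4) = lead_part (l, r)"
proof -
  have "Min (mdeg ` Poly_Mapping.keys (mon l - mon r :: 'k poly4)) = mdeg l"
    using assms by (simp add: keys_binomial)
  then show ?thesis
    using assms hom_component_eq_sum[of "{l, r}" "mon l - mon r :: 'k poly4" "mdeg l"]
    by (auto simp: initial_form_def keys_binomial lead_part_def lookup_minus lookup_single
      when_def single_uminus)
qed

definition rewrite_rule :: "(4 \<Rightarrow> nat) \<Rightarrow> (4 \<Rightarrow>\<^sub>0 nat) \<times> (4 \<Rightarrow>\<^sub>0 nat) \<Rightarrow> bool" where
  "rewrite_rule n = (\<lambda>(l, r). weight n l = weight n r \<and>
     (mdeg l < mdeg r \<or> mdeg l = mdeg r \<and> Poly_Mapping.lookup l 1 < Poly_Mapping.lookup r 1))"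

text \<open>A rule that raises the degree has \<open>mon l\<close> in \<open>J\<close>, which puts
  \<open>mon u\<close> into \<open>J\<close> at once. A rule that keeps the degree changes
  \<open>mon u\<close> by an element of \<open>J\<close>.\<close>

lemma exists_reduced:
  fixes n :: "4 \<Rightarrow> nat" and R :: "((4 \<Rightarrow>\<^sub>0 nat) \<times> (4 \<Rightarrow>\<^sub>0 nat)) set"
  defines "J \<equiv> (ideal_gen (lead_part ` R) :: 'k::comm_ring_1 poly4 set)"
  assumes pos: "\<And>i. 0 < n i" and R: "\<And>p. p \<in> R \<Longrightarrow> rewrite_rule n p"
  shows "\<exists>v. reduced R v \<and> weight n v = weight n u \<and> mdeg u \<le> mdeg v \<and>
    (if mdeg u < mdeg v then mon u \<in> J else mon u - mon v \<in> J)"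
proof -
  have mdeg_le: "mdeg v \<le> weight n v" for v
    unfolding mdeg_def weight_def using pos by (intro sum_mono) (simp add: Suc_le_eq)
  have lookup_le: "Poly_Mapping.lookup v 1 \<le> mdeg v" for v
    unfolding mdeg_def by (intro member_le_sum) auto
  \<comment> \<open>A step keeps the weight, which bounds the degree and the exponent of x_1 because
    all \<open>n i\<close> are positive. Hence the truncated differences really decrease
    lexicographically.\<close>
  let ?M = "measures [\<lambda>u. weight n u - mdeg u, \<lambda>u. weight n u - Poly_Mapping.lookup u 1]"
  have "wf ?M" by simp
  then show ?thesis
  proof (induction u rule: wf_induct_rule)
    case (less u)
    show ?case
    proof (cases "reduced R u")
      case True
      then show ?thesis
        by (intro exI[of _ u]) (simp add: J_def ideal_gen_def Modules.module.span_zero[OF module_times])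
    next
      case False
      then obtain l r v where lr: "(l, r) \<in> R" "u = v + l"
        by (auto simp: reduced_def exp_dvd_def)
      let ?u = "v + r"
      have rule: "weight n l = weight n r" "mdeg l < mdeg r \<or> mdeg l = mdeg r \<and> Poly_Mapping.lookup l 1 < Poly_Mapping.lookup r 1"
        using R[OF lr(1)] by (auto simp: rewrite_rule_def)
      have wt: "weight n ?u = weight n u"
        using rule by (simp add: lr weight_add)
      have deg: "mdeg ?u + mdeg l = mdeg u + mdeg r"
        by (simp add: lr mdeg_add)
      have "Poly_Mapping.lookup u 1 < Poly_Mapping.lookup ?u 1" if "mdeg l = mdeg r"
        using rule(2) that by (simp add: lr lookup_add)
      then have "(?u, u) \<in> ?M"
        using rule(2) wt deg mdeg_le[of ?u] lookup_le[of ?u] by auto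
      from less[OF this] obtain w where w: "reduced R w" "weight n w = weight n u" "mdeg ?u \<le> mdeg w"
        "if mdeg ?u < mdeg w then mon ?u \<in> J else mon ?u - mon w \<in> J"
        using wt by auto
      have J: "lead_part (l, r) \<in> J"
        using lr unfolding J_def by (intro ideal_gen_base imageI)
      have mon: "mon u = mon v * (mon l :: 'k poly4)" "mon ?u = mon v * (mon r :: 'k poly4)"
        by (simp_all add: lr mult_single)
      show ?thesis
      proof (intro exI[of _ w] conjI)
        show "mdeg u \<le> mdeg w" using deg w(3) rule(2) by auto
        show "if mdeg u < mdeg w then mon u \<in> J else mon u - mon w \<in> J"
        proof (cases "mdeg l < mdeg r")
          case True
          then have "mon l \<in> J" using J by (simp add: lead_part_def)
          then have "mon u \<in> J" unfolding mon J_def by (rule ideal_gen_mult)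
          then show ?thesis using True deg w(3) by auto
        next
          case False
          then have eq: "mdeg ?u = mdeg u" using rule(2) deg by auto
          have "mon l - mon r \<in> J" using J False by (simp add: lead_part_def)
          then have *: "mon u - mon ?u \<in> J"
            unfolding mon right_diff_distrib[symmetric] J_def by (rule ideal_gen_mult)
          then show ?thesis
            using w(4) ideal_gen_add[of "mon u - mon ?u" "lead_part ` R" "mon ?u"]
              ideal_gen_add[of "mon u - mon ?u" "lead_part ` R" "mon ?u - mon w"]
            by (auto simp: eq J_def)
        qed
      qed (use w in auto)
    qed
  qed
qed

text \<open>
  Rewriting never lowers the degree, so a reduced monomial that is unique in its weight has the
  largest degree in its weight. A monomial of smaller degree, and a difference of two monomials
  of that largest degree, then reduce to zero by the leading parts of the rules alone.
\<close>

lemma tangent_ideal_eq_if_inj_on_reduced: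
  fixes n :: "4 \<Rightarrow> nat" and R :: "((4 \<Rightarrow>\<^sub>0 nat) \<times> (4 \<Rightarrow>\<^sub>0 nat)) set"
  assumes pos: "\<And>i. 0 < n i" and R: "\<And>p. p \<in> R \<Longrightarrow> rewrite_rule n p"
    and inj: "inj_on (weight n) {u. reduced R u}"
  shows "tangent_ideal (curve_ideal n) = (ideal_gen (lead_part ` R) :: 'k::field poly4 set)"
    (is "_ = ?J")
proof
  have "initial_form f \<in> ?J" if f: "f \<in> curve_ideal n" "f \<noteq> 0" for f :: "'k poly4"
  proof -
    obtain nf where nf: "reduced R (nf u)" "weight n (nf u) = weight n u" "mdeg u \<le> mdeg (nf u)"
        "if mdeg u < mdeg (nf u) then mon u \<in> ?J else mon u - mon (nf u) \<in> ?J" for u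
      using exists_reduced[of n R, OF pos R] by metis
    have nf_eq_iff: "nf u = nf v \<longleftrightarrow> weight n u = weight n v" for u v
      using inj nf(1,2) by (metis inj_onD mem_Collect_eq)
    let ?K = "Poly_Mapping.keys f"
    define d where "d = Min (mdeg ` ?K)"
    have d: "d \<le> mdeg m" if "m \<in> ?K" for m
      unfolding d_def using that by simp
    \<comment> \<open>The part of degree \<open>d\<close> after every monomial of \<open>f\<close>
      is replaced by its normal form. Normal forms correspond to weights, so a coefficient of
      \<open>A\<close> is trivially zero or a coefficient of \<open>curve_hom n f\<close>.\<close>
    define A where "A = (\<Sum>m\<in>?K.
      if mdeg (nf m) = d then Poly_Mapping.single (nf m) (Poly_Mapping.lookup f m) else 0)"
    have "A = 0"
    proof (rule poly_mapping_eqI)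
      fix p
      have "Poly_Mapping.lookup A p =
          (\<Sum>m\<in>?K. if mdeg (nf m) = d \<and> nf m = p then Poly_Mapping.lookup f m else 0)"
        unfolding A_def lookup_sum by (rule sum.cong) (auto simp: lookup_single when_def)
      also have "\<dots> = 0"
      proof (cases "mdeg p = d \<and> p \<in> range nf")
        case True
        then obtain v where v: "p = nf v" "mdeg (nf v) = d" by auto
        have "(\<Sum>m\<in>?K. if mdeg (nf m) = d \<and> nf m = p then Poly_Mapping.lookup f m else 0)
            = (\<Sum>m\<in>?K. if weight n m = weight n v then Poly_Mapping.lookup f m else 0)"
        proof (rule sum.cong)
          fix m
          have "mdeg (nf m) = d \<and> nf m = p \<longleftrightarrow> weight n m = weight n v"
            using v nf_eq_iff by metis
          then show "(if mdeg (nf m) = d \<and> nf m = p then Poly_Mapping.lookup f m else 0)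
              = (if weight n m = weight n v then Poly_Mapping.lookup f m else 0)"
            by simp
        qed simp
        also have "\<dots> = coeff (curve_hom n f) (weight n v)"
          by (simp add: coeff_curve_hom sum.inter_filter)
        also have "\<dots> = 0" using f by (simp add: curve_ideal_def)
        finally show ?thesis .
      next
        case False
        then show ?thesis by (intro sum.neutral) auto
      qed
      finally show "Poly_Mapping.lookup A p = Poly_Mapping.lookup 0 p" by simp
    qed
    have scale: "Poly_Mapping.single 0 c * mon m = Poly_Mapping.single m (c :: 'k)" for c and m :: "4 \<Rightarrow>\<^sub>0 nat"
      by (simp add: mult_single)
    \<comment> \<open>The initial form and \<open>A\<close> are compared term by term. A monomial of
      degree above \<open>d\<close> contributes to neither, as normal forms do not lose
      degree.\<close>
    have "(if mdeg m = d then Poly_Mapping.single m (Poly_Mapping.lookup f m) else 0) -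
        (if mdeg (nf m) = d then Poly_Mapping.single (nf m) (Poly_Mapping.lookup f m) else 0) \<in> ?J"
      if m: "m \<in> ?K" for m
    proof (cases "mdeg m = d")
      case True
      show ?thesis
      proof (cases "mdeg (nf m) = d")
        case eq: True
        have "Poly_Mapping.single 0 (Poly_Mapping.lookup f m) * (mon m - mon (nf m)) \<in> ?J"
          by (rule ideal_gen_mult) (use nf(4)[of m] True eq in auto)
        then show ?thesis using True eq by (simp add: right_diff_distrib scale)
      next
        case neq: False
        have "Poly_Mapping.single 0 (Poly_Mapping.lookup f m) * mon m \<in> ?J"
          by (rule ideal_gen_mult) (use nf(3,4)[of m] True neq in auto)
        then show ?thesis using True neq by (simp add: scale)
      qed
    next
      case False
      then have "mdeg (nf m) \<noteq> d" using d[OF m] nf(3)[of m] by auto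
      then show ?thesis
        using False by (simp add: ideal_gen_def Modules.module.span_zero[OF module_times])
    qed
    then have "initial_form f - A \<in> ?J"
      unfolding initial_form_def d_def[symmetric] A_def hom_component_eq_sum[OF finite_keys subset_refl]
        sum_subtractf[symmetric] by (rule ideal_gen_sum)
    with \<open>A = 0\<close> show ?thesis by simp
  qed
  then show "tangent_ideal (curve_ideal n) \<subseteq> ?J"
    unfolding tangent_ideal_def by (intro ideal_gen_subsetI) auto
next
  \<comment> \<open>Conversely, each leading part is the initial form of its own binomial, which
    lies in the curve ideal because the weights agree.\<close>
  have "lead_part p \<in> {initial_form f | f. f \<in> curve_ideal n \<and> f \<noteq> (0 :: 'k poly4)}"
    if "p \<in> R" for p
  proof -
    obtain l r where lr: "p = (l, r)" by (cases p)
    have "l \<noteq> r" "mdeg l \<le> mdeg r" "weight n l = weight n r"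
      using R[OF that] by (auto simp: lr rewrite_rule_def)
    moreover from \<open>l \<noteq> r\<close> have "mon l - mon r \<noteq> (0 :: 'k poly4)"
      using keys_binomial[of l r, where ?'k = 'k] by auto
    ultimately show ?thesis
      by (auto simp: lr initial_form_binomial binomial_mem_curve_ideal_iff
        intro!: exI[of _ "mon l - mon r"])
  qed
  then show "?J \<subseteq> tangent_ideal (curve_ideal n)"
    unfolding tangent_ideal_def by (intro ideal_gen_mono) auto
qed

section \<open>Gorenstein monomial curves\<close>

text \<open>
  Modulo \<open>x\<^sub>1\<close> every generator except \<open>f\<^sub>3\<close> becomes a monomial. Hence the coefficient of a
  reduced monomial \<open>u\<close> free of \<open>x\<^sub>1\<close>, plus the coefficient of the monomial \<open>u'\<close> obtained from \<open>u\<close>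
  by \<open>f\<^sub>3\<close> if \<open>x\<^sub>3 ^ a3\<close> divides \<open>u\<close>, is a functional that annihilates the curve ideal.
\<close>

lemma reduced_eq_if_weight_eq:
  fixes n :: "4 \<Rightarrow> nat"
  defines "I \<equiv> (curve_ideal n :: 'k::field poly4 set)"
  assumes gens: "I = ideal_gen
       {mon (expo a1 0 0 0) - mon (expo 0 0 a13 a14),
        mon (expo 0 a2 0 0) - mon (expo a21 0 a23 0),
        mon (expo 0 0 a3 0) - mon (expo 0 a32 0 a34),
        mon (expo 0 0 0 a4) - mon (expo a41 a42 0 0),
        mon (expo a21 0 0 a34) - mon (expo 0 a42 a13 0)}"
    and pos: "0 < a1" "0 < a21" "0 < a41" "0 < a32" "0 < a34" "a13 < a3"
    and a2: "a32 + a42 \<le> a2" and a4: "a14 + a34 \<le> a4"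
    and red: "\<not> (a13 \<le> c \<and> a14 \<le> d)" "b < a2" "\<not> (a32 \<le> b \<and> a34 \<le> d)" "d < a4"
      "\<not> (a42 \<le> b \<and> a13 \<le> c)" "c < a3 + a13"
    and v: "\<not> exp_dvd (expo 0 a32 0 a34) v"
    and wt: "weight n (expo 0 b c d) = weight n v"
  shows "v = expo 0 b c d"
proof -
  let ?u = "expo 0 b c d" and ?u' = "expo 0 (b + a32) (c - a3) (d + a34)"
  have mem: "mon ?u - mon v \<in> I"
    using wt by (simp add: I_def binomial_mem_curve_ideal_iff)
  show ?thesis
  proof (cases "c < a3")
    case True
    \<comment> \<open>In this case no monomial of any generator divides \<open>?u\<close>.\<close>
    have "Poly_Mapping.lookup (mon ?u - mon v :: 'k poly4) ?u = 0"
      using mem unfolding gens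
      by (rule lookup_ideal_gen_eq_0)
        (use pos red True in \<open>auto dest!: keys_binomialD\<close>)
    then show ?thesis by (auto simp: lookup_minus lookup_single when_def split: if_splits)
  next
    case False
    \<comment> \<open>From \<open>a13 < a3 \<le> c\<close> follow \<open>d < a14\<close> and
      \<open>b < a42\<close>. Then \<open>a2\<close> and \<open>a4\<close> show that only the two
      monomials of f_3 divide \<open>?u\<close> or \<open>?u'\<close>, each with the same cofactor,
      so the two contributions cancel.\<close>
    have "Poly_Mapping.lookup f ?u + Poly_Mapping.lookup f ?u' = 0" if "f \<in> I" for f
      using that unfolding gens
    proof (induction rule: ideal_gen_induct_monomial)
      case (gen w k g)
      obtain p q r s where w: "w = expo p q r s" by (rule expo_cases)
      show ?case
        using gen pos red False a2 a4
        by (auto simp: w right_diff_distrib mult_single lookup_minus lookup_single when_def)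
    qed (simp_all add: lookup_add algebra_simps add_eq_0_iff)
    from this[OF mem] have "v = ?u \<or> v = ?u'"
      using pos by (auto simp: lookup_minus lookup_single when_def split: if_splits)
    moreover have "v \<noteq> ?u'" using v by auto
    ultimately show ?thesis by blast
  qed
qed

text \<open>The binomial \<open>mon u - mon v\<close> lies in the ideal with coefficient 1 at
  \<open>u\<close>, so \<open>u\<close> cannot avoid all monomials of the generators. This excludes
  equal weights of small powers of the variables.\<close>

lemma no_short_relation:
  fixes n :: "4 \<Rightarrow> nat"
  assumes gens: "curve_ideal n = (ideal_gen S :: 'k::field poly4 set)"
    and wt: "weight n u = weight n v" "u \<noteq> v"
  shows "\<exists>g\<in>S. \<exists>m\<in>Poly_Mapping.keys g. exp_dvd m u"
proof (rule ccontr)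
  assume *: "\<not> ?thesis"
  have "(mon u - mon v :: 'k poly4) \<in> ideal_gen S"
    using wt by (simp add: gens[symmetric] binomial_mem_curve_ideal_iff)
  then have "Poly_Mapping.lookup (mon u - mon v :: 'k poly4) u = 0"
    by (rule lookup_ideal_gen_eq_0) (use * in blast)
  with \<open>u \<noteq> v\<close> show False by (simp add: lookup_minus lookup_single)
qed

theorem theorem2p9:
  fixes n :: "4 \<Rightarrow> nat"
    and a1 a2 a3 a4 a13 a14 a21 a23 a32 a34 a41 a42 :: nat
  defines "I \<equiv> (curve_ideal n :: 'k::field poly4 set)"
  assumes n_order: "0 < n 1" "n 1 < n 2" "n 2 < n 3" "n 3 < n 4"
    and n_gcd: "Gcd (n ` UNIV) = 1"
    and gorenstein: "gorenstein_curve n"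
    and not_ci: "\<not> complete_intersection_curve I"
    and cm: "cm_tangent_cone I"
    and gens: "minimally_generated_by I
       [xvar 1 ^ a1 - xvar 3 ^ a13 * xvar 4 ^ a14,
        xvar 2 ^ a2 - xvar 1 ^ a21 * xvar 3 ^ a23,
        xvar 3 ^ a3 - xvar 2 ^ a32 * xvar 4 ^ a34,
        xvar 4 ^ a4 - xvar 1 ^ a41 * xvar 2 ^ a42,
        xvar 1 ^ a21 * xvar 4 ^ a34 - xvar 2 ^ a42 * xvar 3 ^ a13]"
    and exps_gt_1: "1 < a1" "1 < a2" "1 < a3" "1 < a4"
    and exps_col1: "0 < a21" "a21 < a1" "0 < a41" "a41 < a1"
    and exps_col2: "0 < a32" "a32 < a2" "0 < a42" "a42 < a2"
    and exps_col3: "0 < a13" "a13 < a3" "0 < a23" "a23 < a3"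
    and exps_col4: "0 < a14" "a14 < a4" "0 < a34" "a34 < a4"
    and "a3 > a32 + a34"
    and "a32 < a42"
    and "a14 \<le> a34"
    and "a2 \<le> a21 + a23"
    and "a42 + a13 \<le> a21 + a34"
    and "a3 + a13 \<le> a1 + a32 + a34 - a14"
  shows "minimally_generated_by (tangent_ideal I)
       [xvar 3 ^ a13 * xvar 4 ^ a14,
        if a2 < a21 + a23 then xvar 2 ^ a2
          else xvar 2 ^ a2 - xvar 1 ^ a21 * xvar 3 ^ a23,
        xvar 2 ^ a32 * xvar 4 ^ a34,
        xvar 4 ^ a4,
        if a42 + a13 < a21 + a34 then xvar 2 ^ a42 * xvar 3 ^ a13
          else xvar 1 ^ a21 * xvar 4 ^ a34 - xvar 2 ^ a42 * xvar 3 ^ a13,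
        if a3 + a13 < a1 + a32 + a34 - a14 then xvar 3 ^ (a3 + a13)
          else xvar 3 ^ (a3 + a13) - xvar 1 ^ a1 * xvar 2 ^ a32 * xvar 4 ^ (a34 - a14)]"
proof -
  let ?F = "{mon (expo a1 0 0 0) - mon (expo 0 0 a13 a14),
        mon (expo 0 a2 0 0) - mon (expo a21 0 a23 0),
        mon (expo 0 0 a3 0) - mon (expo 0 a32 0 a34),
        mon (expo 0 0 0 a4) - mon (expo a41 a42 0 0),
        mon (expo a21 0 0 a34) - mon (expo 0 a42 a13 0)} :: 'k poly4 set"
  have gen_F: "curve_ideal n = ideal_gen ?F"
    using gens by (simp add: minimally_generated_by_def I_def xvar_power_expo mult_single)
  have w: "weight n u = weight n v" if "mon u - mon v \<in> ?F" for u v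
    using ideal_gen_base[OF that] by (simp add: gen_F[symmetric] binomial_mem_curve_ideal_iff)
  have w1: "a1 * n 1 = a13 * n 3 + a14 * n 4"
    using w[of "expo a1 0 0 0"] by (force simp: weight_expo)
  have w2: "a2 * n 2 = a21 * n 1 + a23 * n 3"
    using w[of "expo 0 a2 0 0"] by (force simp: weight_expo)
  have w3: "a3 * n 3 = a32 * n 2 + a34 * n 4"
    using w[of "expo 0 0 a3 0"] by (force simp: weight_expo)
  have w4: "a4 * n 4 = a41 * n 1 + a42 * n 2"
    using w[of "expo 0 0 0 a4"] by (force simp: weight_expo)
  have w5: "a21 * n 1 + a34 * n 4 = a42 * n 2 + a13 * n 3"
    using w[of "expo a21 0 0 a34"] by (force simp: weight_expo)

  txt \<open>
    Bresinsky's relations: otherwise a power of \<open>x\<^sub>3\<close> (of \<open>x\<^sub>4\<close>) below \<open>a3\<close> (below \<open>a4\<close>) would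
    have the weight of a power of \<open>x\<^sub>2\<close> (of \<open>x\<^sub>1\<close>).
  \<close>
  have no3: False if "weight n (expo 0 0 e 0) = weight n (expo 0 k 0 0)" "0 < e" "e < a3" for e k
    using no_short_relation[OF gen_F that(1)] that(2,3)
      exps_gt_1 exps_col1 exps_col2 exps_col3 exps_col4
    by (auto dest!: keys_binomialD)
  have no4: False if "weight n (expo 0 0 0 e) = weight n (expo k 0 0 0)" "0 < e" "e < a4" for e k
    using no_short_relation[OF gen_F that(1)] that(2,3)
      exps_gt_1 exps_col1 exps_col2 exps_col3 exps_col4
    by (auto dest!: keys_binomialD)
  \<comment> \<open>For \<open>x \<le> x'\<close> both truncated sides are 0.\<close>
  have cancel: "(x - x') * p = (y' - y) * q"
    if "x * p + y * q = x' * p + y' * q" for x x' y y' p q :: nat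
    using that by (simp add: diff_mult_distrib)
  \<comment> \<open>Adding the relations of f_2, f_3 and f_5 cancels the terms in n_1 and n_4. In
    \<open>rel4\<close>, those of f_1, f_4 and f_5 cancel the terms in n_2 and n_3.\<close>
  have rel3: "a3 * n 3 + a2 * n 2 = (a13 + a23) * n 3 + (a42 + a32) * n 2"
    using w2 w3 w5 by (simp add: algebra_simps)
  have "a3 = a13 + a23"
  proof (rule linorder_cases)
    assume "a3 < a13 + a23"
    moreover from this have "a13 + a23 - a3 < a3"
      using exps_col3 by simp
    ultimately show ?thesis
      using no3[of "a13 + a23 - a3"] cancel[OF rel3[symmetric]] exps_col3
      by (auto simp: weight_expo)
  next
    assume "a13 + a23 < a3"
    then show ?thesis
      using no3[of "a3 - (a13 + a23)"] cancel[OF rel3] exps_col3 by (auto simp: weight_expo)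
  qed
  then have a2: "a2 = a32 + a42"
    using rel3 n_order by simp
  have rel4: "(a14 + a34) * n 4 + (a21 + a41) * n 1 = a4 * n 4 + a1 * n 1"
    using w1 w4 w5 by (simp add: algebra_simps)
  have a4: "a4 = a14 + a34"
  proof (rule linorder_cases)
    assume "a4 < a14 + a34"
    moreover from this have "a14 + a34 - a4 < a4"
      using exps_col4 by simp
    ultimately show ?thesis
      using no4[of "a14 + a34 - a4"] cancel[OF rel4] exps_col4 by (auto simp: weight_expo)
  next
    assume "a14 + a34 < a4"
    then show ?thesis
      using no4[of "a4 - (a14 + a34)"] cancel[OF rel4[symmetric]] exps_col4
      by (auto simp: weight_expo)
  qed

  \<comment> \<open>The sixth rule comes from f_6 = x_3^a13 f_3 - x_2^a32 x_4^(a34 - a14) f_1, where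
    both products contain x_2^a32 x_3^a13 x_4^a34.\<close>
  define R where "R = {(expo 0 0 a13 a14, expo a1 0 0 0), (expo 0 a2 0 0, expo a21 0 a23 0),
    (expo 0 a32 0 a34, expo 0 0 a3 0), (expo 0 0 0 a4, expo a41 a42 0 0),
    (expo 0 a42 a13 0, expo a21 0 0 a34), (expo 0 0 (a3 + a13) 0, expo a1 a32 0 (a34 - a14))}"
  have pos: "0 < n i" for i
    using n_order exhaust_4[of i] by auto
  \<comment> \<open>The rules for f_1 and f_4 raise the degree because n_1 is the least weight and
    n_4 the greatest.\<close>
  have "(a13 + a14) * n 1 < a1 * n 1"
    using n_order exps_col3 exps_col4 by (simp add: w1 algebra_simps add_strict_mono)
  then have deg1: "a13 + a14 < a1" by simp
  have "a4 * n 4 < (a41 + a42) * n 4"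
    using n_order exps_col1 exps_col2 by (simp add: w4 algebra_simps add_strict_mono)
  then have deg4: "a4 < a41 + a42" by simp
  have a34: "a1 + a32 + a34 - a14 = a1 + a32 + (a34 - a14)"
    using \<open>a14 \<le> a34\<close> by simp
  have w6: "(a3 + a13) * n 3 = a1 * n 1 + a32 * n 2 + (a34 - a14) * n 4"
  proof -
    have "a34 * n 4 = (a34 - a14) * n 4 + a14 * n 4"
      using \<open>a14 \<le> a34\<close> by (simp add: add_mult_distrib[symmetric])
    then show ?thesis using w1 w3 by (simp add: algebra_simps)
  qed
  have rule: "rewrite_rule n p" if "p \<in> R" for p
  proof -
    have "a2 < a21 + a23 \<or> a2 = a21 + a23 \<and> 0 < a21"
      and "a42 + a13 < a21 + a34 \<or> a42 + a13 = a21 + a34 \<and> 0 < a21"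
      and "a3 + a13 < a1 + a32 + (a34 - a14) \<or> a3 + a13 = a1 + a32 + (a34 - a14) \<and> 0 < a1"
      using assms(26-) exps_col1 exps_gt_1 unfolding a34 by linarith+
    then show ?thesis
      using that deg1 deg4 \<open>a32 + a34 < a3\<close> unfolding R_def
      by (elim insertE emptyE) (simp_all add: rewrite_rule_def weight_expo w1 w2 w3 w4 w5 w6)
  qed
  have reduced_iff: "reduced R (expo a b c d) \<longleftrightarrow> \<not> (a13 \<le> c \<and> a14 \<le> d) \<and> b < a2 \<and>
      \<not> (a32 \<le> b \<and> a34 \<le> d) \<and> d < a4 \<and> \<not> (a42 \<le> b \<and> a13 \<le> c) \<and> c < a3 + a13" for a b c d
    by (auto simp: reduced_def R_def not_le)
  have inj: "inj_on (weight n) {u. reduced R u}"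
  proof -
    have *: "u = v"
      if "reduced R u" "reduced R v" "weight n u = weight n v"
        "Poly_Mapping.lookup u 1 \<le> Poly_Mapping.lookup v 1" for u v
    proof -
      obtain a b c d where u: "u = expo a b c d" by (rule expo_cases)
      obtain a' b' c' d' where v: "v = expo a' b' c' d'" by (rule expo_cases)
      \<comment> \<open>A common power of x_1 can be divided out: it shifts both weights equally,
        and no left-hand side of a rule contains x_1.\<close>
      obtain k where k: "a' = a + k"
        using \<open>Poly_Mapping.lookup u 1 \<le> Poly_Mapping.lookup v 1\<close> by (auto simp: u v le_iff_add)
      have "expo k b' c' d' = expo 0 b c d"
      proof (rule reduced_eq_if_weight_eq[OF gen_F])
        show "weight n (expo 0 b c d) = weight n (expo k b' c' d')"
          using \<open>weight n u = weight n v\<close> by (simp add: u v k weight_expo add_mult_distrib)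
      qed (use that a2 a4 exps_gt_1 exps_col1 exps_col2 exps_col3 exps_col4
          in \<open>simp_all add: u v reduced_iff\<close>)
      then show ?thesis by (simp add: u v k)
    qed
    then show ?thesis by (intro inj_onI) (metis linear mem_Collect_eq)
  qed
  have tangent: "tangent_ideal I = ideal_gen (lead_part ` R)"
    unfolding I_def using pos rule inj by (rule tangent_ideal_eq_if_inj_on_reduced)
  \<comment> \<open>The left-hand sides of the rules serve as leading monomials, since each occurs
    in its generator in both branches of the conditionals.\<close>
  show ?thesis
  proof (rule minimally_generated_by_if_lead[where ls = "[expo 0 0 a13 a14, expo 0 a2 0 0,
      expo 0 a32 0 a34, expo 0 0 0 a4, expo 0 a42 a13 0, expo 0 0 (a3 + a13) 0]"],
      goal_cases)
    case 1
    show ?case unfolding tangent a34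
      by (rule ideal_gen_eq_up_to_sign)
        (use deg1 deg4 \<open>a32 + a34 < a3\<close>
          in \<open>auto simp: R_def lead_part_def xvar_power_expo mult_single\<close>)
  next
    case (2 i)
    then show ?case using exps_gt_1 exps_col1
      by (auto simp: less_Suc_eq xvar_power_expo mult_single lookup_minus lookup_single when_def)
  next
    case (3 i j m)
    \<comment> \<open>These sets contain the supports of the generators whichever branch applies,
      which avoids a case split in the divisibility check.\<close>
    let ?supports = "[{expo 0 0 a13 a14}, {expo 0 a2 0 0, expo a21 0 a23 0}, {expo 0 a32 0 a34},
      {expo 0 0 0 a4}, {expo 0 a42 a13 0, expo a21 0 0 a34},
      {expo 0 0 (a3 + a13) 0, expo a1 a32 0 (a34 - a14)}]"
    have "m \<in> ?supports ! j"
      using 3(2,4) by (auto simp: less_Suc_eq xvar_power_expo mult_single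
          dest!: keys_binomialD split: if_splits)
    then show ?case using 3(1,2,3) exps_gt_1 exps_col1 exps_col2 exps_col3 exps_col4
      by (auto simp: less_Suc_eq)
  qed
qed

end
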